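(* Let $n, m$ be integers with $2 \le m \le n$, let $0 = t_1 < t_2 < \dots < t_m = 1$, let $A : [0,1] \to \mathbb{R}^{n\times n}$ and $f : [0,1] \to \mathbb{R}^n$ be continuous, let $F_1, \dots, F_m \in \mathbb{R}^{n \times n}$ be constant matrices, and let $\alpha \in \mathbb{R}^n$. Let $\Phi$ be any fundamental matrix of the homogeneous system $\dot{x} = A(t)x$ on $[0,1]$, and let $\Phi_1, \dots, \Phi_m : [0,1] \to \mathbb{R}^{n\times n}$ be any matrix functions with $$\dot{\Phi}_k(t) = A(t)\Phi_k(t) \quad (k = 1,\dots,m), \qquad \sum_{k=1}^m \Phi_k(t) = \Phi(t), \qquad t \in [0,1].$$ Put $F = \sum_{j=1}^m F_j \Phi(t_j)$ and assume $\det F \neq 0$. Then the many-point boundary value problem $$\dot{x} = A(t)x + f(t), \quad t \in [0,1], \qquad \sum_{j=1}^m F_j x(t_j) = \alpha$$ has a unique solution $x : [0,1] \to \mathbb{R}^n$, and it is given by $$x(t) = \Phi(t) C + \sum_{k=1}^m \Phi_k(t) \int_{t_k}^t \Phi^{-1}(s) f(s)\, ds, \qquad t \in [0,1],$$ where $$C = F^{-1}\left( \alpha - \sum_{j=1}^m F_j \sum_{k=1}^m \Phi_k(t_j) \int_{t_k}^{t_j} \Phi^{-1}(s) f(s)\, ds \right).$$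
   Context: A fundamental matrix of $\dot{x} = A(t)x$ on $[0,1]$ is a continuously differentiable $\Phi : [0,1] \to \mathbb{R}^{n\times n}$ with $\dot{\Phi}(t) = A(t)\Phi(t)$ and $\Phi(t)$ invertible for all $t \in [0,1]$. The matrices $\Phi_k(t)$ are $n\times n$ matrix solutions of the same homogeneous equation and are not required to be invertible. A solution of the boundary value problem is a continuously differentiable function $x : [0,1] \to \mathbb{R}^n$ satisfying the differential equation on $[0,1]$ and the boundary condition. *)

theory Defs
  imports "HOL-Analysis.Analysis"
begin

text \<open>
  Functions on \<open>[0,1]\<close> are modelled by total functions on \<open>real\<close> whose values outside \<open>{0..1}\<close>
  are irrelevant. Derivatives are therefore taken within \<open>{0..1}\<close>, i.e. one-sided at the endpoints
  (\<open>C1_differentiable_on\<close> would instead demand two-sided derivatives there).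
\<close>

definition cont_differentiable_on :: "(real \<Rightarrow> 'a::real_normed_vector) \<Rightarrow> real set \<Rightarrow> bool" where
  "cont_differentiable_on x S \<longleftrightarrow>
     (\<exists>D. continuous_on S D \<and> (\<forall>t\<in>S. (x has_vector_derivative D t) (at t within S)))"

definition homogeneous_matrix_solution ::
    "(real \<Rightarrow> real^'n^'n) \<Rightarrow> (real \<Rightarrow> real^'n^'n) \<Rightarrow> bool" where
  "homogeneous_matrix_solution A \<Psi> \<longleftrightarrow>
     (\<forall>t\<in>{0..1}. (\<Psi> has_vector_derivative A t ** \<Psi> t) (at t within {0..1}))"

definition fundamental_matrix ::
    "(real \<Rightarrow> real^'n^'n) \<Rightarrow> (real \<Rightarrow> real^'n^'n) \<Rightarrow> bool" where
  "fundamental_matrix A \<Phi> \<longleftrightarrow>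
     cont_differentiable_on \<Phi> {0..1} \<and>
     homogeneous_matrix_solution A \<Phi> \<and>
     (\<forall>t\<in>{0..1}. invertible (\<Phi> t))"

definition bvp_solution ::
    "(real \<Rightarrow> real^'n^'n) \<Rightarrow> (real \<Rightarrow> real^'n) \<Rightarrow> nat \<Rightarrow> (nat \<Rightarrow> real) \<Rightarrow> (nat \<Rightarrow> real^'n^'n) \<Rightarrow>
     real^'n \<Rightarrow> (real \<Rightarrow> real^'n) \<Rightarrow> bool" where
  "bvp_solution A f m t Fs \<alpha> x \<longleftrightarrow>
     cont_differentiable_on x {0..1} \<and>
     (\<forall>\<tau>\<in>{0..1}. (x has_vector_derivative A \<tau> *v x \<tau> + f \<tau>) (at \<tau> within {0..1})) \<and>
     (\<Sum>j=1..m. Fs j *v x (t j)) = \<alpha>"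

end

(*
  Variation of constants, with the weight Phi split as the sum of the Phi_k: differentiating
  Phi_k(t) times the integral of Phi^-1 f from t_k to t leaves the residue Phi_k Phi^-1 f, and these
  residues add up to f whatever the base points t_k are. The boundary condition is then the linear
  equation F C = ... for the free constant. For uniqueness, the difference of two solutions is
  Phi c by uniqueness of the initial value problem, and the boundary condition says F c = 0.
*)
theory Submission
  imports Defs
begin

lemma bounded_bilinear_matrix_vector_mult:
  "bounded_bilinear ((*v) :: real^'n^'m \<Rightarrow> real^'n \<Rightarrow> real^'m)"
  unfolding bilinear_conv_bounded_bilinear [symmetric] bilinear_def
  by (intro conjI allI linearI)
     (simp_all add: algebra_simps matrix_vector_mult_scaleR scaleR_matrix_vector_assoc)

lemmas has_vector_derivative_matrix_vector_mult =
  bounded_bilinear.has_vector_derivative [OF bounded_bilinear_matrix_vector_mult]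

lemmas continuous_on_matrix_vector_mult =
  bounded_bilinear.continuous_on [OF bounded_bilinear_matrix_vector_mult]

lemma sum_matrix_vector_mult:
  "(\<Sum>i\<in>I. M i) *v (x::'a::comm_semiring_1^'n) = (\<Sum>i\<in>I. M i *v x)"
  by (induction I rule: infinite_finite_induct)
     (simp_all add: matrix_vector_mult_add_rdistrib matrix_vector_mult_0)

lemma matrix_vector_mult_sum:
  "M *v (\<Sum>i\<in>I. x i :: 'a::comm_semiring_1^'n) = (\<Sum>i\<in>I. M *v x i)"
  by (induction I rule: infinite_finite_induct)
     (simp_all add: matrix_vector_right_distrib matrix_vector_mult_0_right)

lemma continuous_on_det:
  fixes M :: "'a::topological_space \<Rightarrow> real^'n^'n"
  assumes "\<And>i j. continuous_on S (\<lambda>s. M s $ i $ j)"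
  shows "continuous_on S (\<lambda>s. det (M s))"
  unfolding det_def by (intro continuous_intros assms)

lemma matrix_mul_matrix_inv_vector:
  fixes M :: "'a::comm_ring_1^'n^'m"
  assumes "invertible M"
  shows "M *v (matrix_inv M *v v) = v"
proof -
  have "M ** matrix_inv M = mat 1"
    \<comment> \<open>\<open>matrix_inv\<close> is a Hilbert choice, so its defining property is
      available only once some two-sided inverse is known to exist.\<close>
    using someI_ex [OF assms [unfolded invertible_def]] by (simp add: matrix_inv_def)
  then show ?thesis
    by (simp add: matrix_vector_mul_assoc)
qed

text \<open>By Cramer's rule.\<close>

lemma continuous_on_matrix_inv_vector_mult:
  fixes M :: "'a::topological_space \<Rightarrow> real^'n^'n"
  assumes M: "continuous_on S M" and v: "continuous_on S v"
    and inv: "\<And>s. s \<in> S \<Longrightarrow> invertible (M s)"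
  shows "continuous_on S (\<lambda>s. matrix_inv (M s) *v v s)"
proof -
  have det: "det (M s) \<noteq> 0" if "s \<in> S" for s
    using inv [OF that] by (simp add: invertible_det_nz)
  \<comment> \<open>Column \<open>k\<close> of \<open>M s\<close> replaced by \<open>v s\<close>:
    the numerator matrix in Cramer's rule. A determinant is a polynomial in the entries, so each
    quotient is continuous in \<open>s\<close>.\<close>
  let ?N = "\<lambda>k s. (\<chi> i j. if j = k then v s $ i else M s $ i $ j) :: real^'n^'n"
  have "continuous_on S (\<lambda>s. ?N k s $ i $ j)" for k i j
    using M v by (cases "j = k") (auto intro!: continuous_intros)
  then have "continuous_on S (\<lambda>s. \<chi> k. det (?N k s) / det (M s))"
    using M det by (intro continuous_on_vec_lambda continuous_on_divide continuous_on_det)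
      (auto intro!: continuous_intros)
  \<comment> \<open>Cramer's rule identifies every solution of \<open>M s *v x = v s\<close> with
    the vector of quotients; it is applied to \<open>x = matrix_inv (M s) *v v s\<close>.\<close>
  also have "?this \<longleftrightarrow> ?thesis"
    using cramer [OF det, THEN iffD1, OF _ matrix_mul_matrix_inv_vector [OF inv]]
    by (intro continuous_on_cong) simp_all
  finally show ?thesis .
qed

text \<open>A Gronwall argument in energy form: \<open>A\<close> is bounded on the compact interval,
  so the squared norm of \<open>z\<close> grows at most at a fixed exponential rate, and it starts
  at 0. Applied to differences of solutions, this gives uniqueness for the initial value
  problem.\<close>

lemma homogeneous_ivp_zero:
  fixes A :: "real \<Rightarrow> real^'n^'n" and z :: "real \<Rightarrow> real^'n"
  assumes A: "continuous_on {a..b} A"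
    and z: "\<And>t. t \<in> {a..b} \<Longrightarrow> (z has_vector_derivative A t *v z t) (at t within {a..b})"
    and z0: "z a = 0" and t: "t \<in> {a..b}"
  shows "z t = 0"
proof -
  obtain B where B: "\<And>s. s \<in> {a..b} \<Longrightarrow> norm (A s) \<le> B"
    using compact_imp_bounded [OF compact_continuous_image [OF A compact_Icc]]
    unfolding bounded_iff by blast
  obtain K where K: "K > 0"
    "\<And>(M::real^'n^'n) (v::real^'n). norm (M *v v) \<le> norm M * norm v * K"
    using bounded_bilinear.pos_bounded [OF bounded_bilinear_matrix_vector_mult] by blast
  \<comment> \<open>The 2 comes from differentiating \<open>z s \<bullet> z s\<close>,
    \<open>B\<close> bounds \<open>A\<close>, and \<open>K\<close> is the bilinear bound of the
    matrix-vector product.\<close>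
  define L where "L = 2 * B * K"
  have bound: "2 * (z s \<bullet> (A s *v z s)) \<le> L * (z s \<bullet> z s)" if "s \<in> {a..b}" for s
  proof -
    have "z s \<bullet> (A s *v z s) \<le> norm (z s) * norm (A s *v z s)"
      by (rule norm_cauchy_schwarz)
    also have "\<dots> \<le> norm (z s) * (B * norm (z s) * K)"
    proof (rule mult_left_mono)
      have "norm (A s *v z s) \<le> norm (A s) * norm (z s) * K" by (rule K)
      also have "\<dots> \<le> B * norm (z s) * K"
        using B [OF that] K(1) by (intro mult_right_mono) auto
      finally show "norm (A s *v z s) \<le> B * norm (z s) * K" .
    qed simp
    finally show ?thesis
      by (simp add: L_def power2_norm_eq_inner [symmetric] power2_eq_square mult_ac)
  qed
  \<comment> \<open>The exponential weight cancels the largest growth rate that \<open>bound\<close>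
    permits, so \<open>E\<close> cannot increase.\<close>
  define E where "E = (\<lambda>s. exp (- L * s) * (z s \<bullet> z s))"
  have E: "(E has_vector_derivative
      exp (- L * s) * (2 * (z s \<bullet> (A s *v z s)) - L * (z s \<bullet> z s))) (at s within {a..b})"
    if "s \<in> {a..b}" for s
  proof -
    have "((\<lambda>s. exp (- L * s)) has_vector_derivative exp (- L * s) * (- L)) (at s within {a..b})"
      unfolding has_real_derivative_iff_has_vector_derivative [symmetric]
      by (auto intro!: derivative_eq_intros)
    moreover have "((\<lambda>s. z s \<bullet> z s) has_vector_derivative
        z s \<bullet> (A s *v z s) + (A s *v z s) \<bullet> z s) (at s within {a..b})"
      by (intro bounded_bilinear.has_vector_derivative [OF bounded_bilinear_inner] z that)
    ultimately have "(E has_vector_derivative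
        exp (- L * s) * (z s \<bullet> (A s *v z s) + (A s *v z s) \<bullet> z s)
        + exp (- L * s) * (- L) * (z s \<bullet> z s)) (at s within {a..b})"
      unfolding E_def by (rule has_vector_derivative_mult)
    then show ?thesis
      by (simp add: inner_commute algebra_simps)
  qed
  \<comment> \<open>This monotonicity criterion asks for a two-sided derivative only at interior
    points, where it agrees with the one within \<open>{a..b}\<close>; at the endpoints continuity
    is enough.\<close>
  have "E t \<le> E a"
  proof (rule DERIV_nonpos_imp_decreasing_open [where f = E])
    show "a \<le> t" using t by simp
    show "continuous_on {a..t} E"
      using continuous_on_vector_derivative [OF E] t by (auto intro: continuous_on_subset)
    show "\<exists>y. DERIV E s :> y \<and> y \<le> 0" if "a < s" "s < t" for s
    proof (intro exI conjI)
      have s: "s \<in> {a..b}" "s \<in> interior {a..b}" using that t by auto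
      show "DERIV E s :> exp (- L * s) * (2 * (z s \<bullet> (A s *v z s)) - L * (z s \<bullet> z s))"
        using E [OF s(1)] at_within_interior [OF s(2)]
        by (simp add: has_real_derivative_iff_has_vector_derivative)
      show "exp (- L * s) * (2 * (z s \<bullet> (A s *v z s)) - L * (z s \<bullet> z s)) \<le> 0"
        using bound [OF s(1)] by (intro mult_nonneg_nonpos) auto
    qed
  qed
  then have "z t \<bullet> z t \<le> 0"
    by (simp add: E_def z0 mult_le_0_iff not_le)
  then show ?thesis
    by (metis inner_gt_zero_iff not_le)
qed

theorem theorem1:
  fixes A :: "real \<Rightarrow> real^'n^'n"
    and f :: "real \<Rightarrow> real^'n"
    and m :: nat
    and t :: "nat \<Rightarrow> real"
    and Fs :: "nat \<Rightarrow> real^'n^'n"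
    and F :: "real^'n^'n"
    and \<alpha> C :: "real^'n"
    and \<Phi> :: "real \<Rightarrow> real^'n^'n"
    and \<Phi>s :: "nat \<Rightarrow> real \<Rightarrow> real^'n^'n"
  assumes "2 \<le> m" and "m \<le> CARD('n)"
    and "t 1 = 0" and "t m = 1" and "strict_mono_on {1..m} t"
    and "continuous_on {0..1} A" and "continuous_on {0..1} f"
    and "fundamental_matrix A \<Phi>"
    and "\<forall>k\<in>{1..m}. homogeneous_matrix_solution A (\<Phi>s k)"
    and "\<forall>\<tau>\<in>{0..1}. (\<Sum>k=1..m. \<Phi>s k \<tau>) = \<Phi> \<tau>"
    and F: "F = (\<Sum>j=1..m. Fs j ** \<Phi> (t j))"
    and "det F \<noteq> 0"
    and C: "C = matrix_inv F *v
      (\<alpha> - (\<Sum>j=1..m. Fs j *v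
        (\<Sum>k=1..m. \<Phi>s k (t j) *v (LBINT s=t k..t j. matrix_inv (\<Phi> s) *v f s))))"
  shows "\<exists>x. bvp_solution A f m t Fs \<alpha> x \<and>
           (\<forall>y. bvp_solution A f m t Fs \<alpha> y \<longrightarrow> (\<forall>\<tau>\<in>{0..1}. y \<tau> = x \<tau>)) \<and>
           (\<forall>\<tau>\<in>{0..1}. x \<tau> = \<Phi> \<tau> *v C +
              (\<Sum>k=1..m. \<Phi>s k \<tau> *v (LBINT s=t k..\<tau>. matrix_inv (\<Phi> s) *v f s)))"
proof -
  let ?I = "{0..1} :: real set"
  have contA: "continuous_on ?I A" and contf: "continuous_on ?I f"
    and hom_k: "\<And>k \<tau>. \<lbrakk>k \<in> {1..m}; \<tau> \<in> ?I\<rbrakk> \<Longrightarrow>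
          (\<Phi>s k has_vector_derivative A \<tau> ** \<Phi>s k \<tau>) (at \<tau> within ?I)"
    and sum_k: "\<And>\<tau>. \<tau> \<in> ?I \<Longrightarrow> (\<Sum>k=1..m. \<Phi>s k \<tau>) = \<Phi> \<tau>"
    and hom: "\<And>\<tau>. \<tau> \<in> ?I \<Longrightarrow> (\<Phi> has_vector_derivative A \<tau> ** \<Phi> \<tau>) (at \<tau> within ?I)"
    and inv: "\<And>\<tau>. \<tau> \<in> ?I \<Longrightarrow> invertible (\<Phi> \<tau>)"
    using assms unfolding fundamental_matrix_def homogeneous_matrix_solution_def by auto
  have tI: "t k \<in> ?I" if "k \<in> {1..m}" for k
  proof -
    have "mono_on {1..m} t"
      using assms(5) by (rule strict_mono_on_imp_mono_on)
    then have "t 1 \<le> t k" "t k \<le> t m"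
      using that assms(1) by (auto intro: mono_onD)
    then show ?thesis
      using assms(3,4) by simp
  qed
  define g where "g = (\<lambda>s. matrix_inv (\<Phi> s) *v f s)"
  \<comment> \<open>The particular part of the formula: it solves the inhomogeneous equation by
    itself, and \<open>\<Phi> \<tau> *v C\<close> then corrects the boundary value.\<close>
  define p where "p = (\<lambda>\<tau>. \<Sum>k=1..m. \<Phi>s k \<tau> *v (LBINT s=t k..\<tau>. g s))"
  define x where "x = (\<lambda>\<tau>. \<Phi> \<tau> *v C + p \<tau>)"
  have contg: "continuous_on ?I g"
    unfolding g_def
    by (intro continuous_on_matrix_inv_vector_mult continuous_on_vector_derivative [OF hom] contf inv)
  have \<Phi>g: "\<Phi> \<tau> *v g \<tau> = f \<tau>" if "\<tau> \<in> ?I" for \<tau>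
    unfolding g_def using inv [OF that] by (rule matrix_mul_matrix_inv_vector)
  have hom_const: "((\<lambda>\<tau>. \<Phi> \<tau> *v c) has_vector_derivative A \<tau> *v (\<Phi> \<tau> *v c)) (at \<tau> within ?I)"
    if "\<tau> \<in> ?I" for \<tau> c
    using has_vector_derivative_matrix_vector_mult
      [OF hom [OF that] has_vector_derivative_const [of c]]
    by (simp add: matrix_vector_mul_assoc)
  have dp: "(p has_vector_derivative A \<tau> *v p \<tau> + f \<tau>) (at \<tau> within ?I)" if \<tau>: "\<tau> \<in> ?I" for \<tau>
  proof -
    let ?G = "\<lambda>k \<tau>. LBINT s=t k..\<tau>. g s"
    have "(p has_vector_derivative
        (\<Sum>k=1..m. \<Phi>s k \<tau> *v g \<tau> + (A \<tau> ** \<Phi>s k \<tau>) *v ?G k \<tau>)) (at \<tau> within ?I)"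
      unfolding p_def
    proof (intro has_vector_derivative_sum has_vector_derivative_matrix_vector_mult hom_k \<tau>)
      fix k assume "k \<in> {1..m}"
      then show "(?G k has_vector_derivative g \<tau>) (at \<tau> within ?I)"
        \<comment> \<open>The integral is oriented, so the base point \<open>t k\<close> may lie on
          either side of \<open>\<tau>\<close>, as long as both are in the unit interval.\<close>
        using tI [of k] \<tau> contg by (intro interval_integral_FTC2) auto
    qed
    also have "(\<Sum>k=1..m. \<Phi>s k \<tau> *v g \<tau> + (A \<tau> ** \<Phi>s k \<tau>) *v ?G k \<tau>)
        = (\<Sum>k=1..m. \<Phi>s k \<tau>) *v g \<tau> + A \<tau> *v p \<tau>"
      by (simp add: p_def sum.distrib sum_matrix_vector_mult matrix_vector_mult_sum
          matrix_vector_mul_assoc)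
    also have "\<dots> = A \<tau> *v p \<tau> + f \<tau>"
      using sum_k [OF \<tau>] \<Phi>g [OF \<tau>] by simp
    finally show ?thesis .
  qed
  have dx: "(x has_vector_derivative A \<tau> *v x \<tau> + f \<tau>) (at \<tau> within ?I)" if "\<tau> \<in> ?I" for \<tau>
    using has_vector_derivative_add [OF hom_const dp, OF that that]
    by (simp add: x_def algebra_simps)
  \<comment> \<open>On homogeneous solutions \<open>\<Phi> c\<close> the boundary functional acts as
    the matrix \<open>F\<close>. This serves existence with \<open>C\<close> and uniqueness with the
    \<open>c\<close> below.\<close>
  have F_boundary: "(\<Sum>j=1..m. Fs j *v (\<Phi> (t j) *v c)) = F *v c" for c
    by (simp add: F sum_matrix_vector_mult matrix_vector_mul_assoc)
  have F_inv: "invertible F"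
    using \<open>det F \<noteq> 0\<close> by (simp add: invertible_det_nz)
  have "F *v C = \<alpha> - (\<Sum>j=1..m. Fs j *v p (t j))"
    unfolding C p_def g_def by (rule matrix_mul_matrix_inv_vector [OF F_inv])
  then have boundary: "(\<Sum>j=1..m. Fs j *v x (t j)) = \<alpha>"
    using F_boundary [of C] by (simp add: x_def matrix_vector_right_distrib sum.distrib)
  have "continuous_on ?I x"
    by (rule continuous_on_vector_derivative [OF dx])
  \<comment> \<open>Continuity of the derivative is read off from the differential equation, whose
    right-hand side is continuous once \<open>x\<close> is.\<close>
  then have "continuous_on ?I (\<lambda>\<tau>. A \<tau> *v x \<tau> + f \<tau>)"
    by (intro continuous_on_add continuous_on_matrix_vector_mult contA contf)
  then have sol: "bvp_solution A f m t Fs \<alpha> x"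
    unfolding bvp_solution_def cont_differentiable_on_def using dx boundary by blast
  have unique: "y \<tau> = x \<tau>" if y: "bvp_solution A f m t Fs \<alpha> y" and \<tau>: "\<tau> \<in> ?I" for y \<tau>
  proof -
    \<comment> \<open>Chosen so that \<open>\<Phi> c\<close> agrees with \<open>y - x\<close> at 0;
      hence \<open>w\<close> solves the homogeneous equation with initial value 0 and vanishes on
      the whole interval.\<close>
    define c where "c = matrix_inv (\<Phi> 0) *v (y 0 - x 0)"
    define w where "w = (\<lambda>\<tau>. y \<tau> - x \<tau> - \<Phi> \<tau> *v c)"
    have "(w has_vector_derivative A \<tau> *v w \<tau>) (at \<tau> within ?I)" if "\<tau> \<in> ?I" for \<tau>
    proof -
      have "(y has_vector_derivative A \<tau> *v y \<tau> + f \<tau>) (at \<tau> within ?I)"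
        using y that by (auto simp: bvp_solution_def)
      from has_vector_derivative_diff [OF has_vector_derivative_diff [OF this dx] hom_const [of _ c],
          OF that that]
      show ?thesis
        unfolding w_def by (simp add: algebra_simps)
    qed
    moreover have "w 0 = 0"
      using inv [of 0] by (simp add: w_def c_def matrix_mul_matrix_inv_vector)
    ultimately have "w s = 0" if "s \<in> ?I" for s
      using homogeneous_ivp_zero contA that by blast
    then have diff: "y s = x s + \<Phi> s *v c" if "s \<in> ?I" for s
      using that by (simp add: w_def algebra_simps)
    have "\<alpha> = (\<Sum>j=1..m. Fs j *v y (t j))"
      using y by (simp add: bvp_solution_def)
    \<comment> \<open>The identity \<open>diff\<close> holds only on the unit interval, hence the
      appeal to \<open>tI\<close> for the points \<open>t j\<close>.\<close>
    also have "\<dots> = (\<Sum>j=1..m. Fs j *v x (t j) + Fs j *v (\<Phi> (t j) *v c))"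
      using tI by (intro sum.cong) (simp_all add: diff matrix_vector_right_distrib)
    also have "\<dots> = \<alpha> + F *v c"
      using boundary F_boundary [of c] by (simp add: sum.distrib)
    finally have "F *v c = 0"
      by simp
    then have "c = 0"
      using F_inv by (metis invertible_def matrix_left_invertible_ker)
    then show ?thesis
      using diff [OF \<tau>] by simp
  qed
  have "\<forall>\<tau>\<in>?I. x \<tau> = \<Phi> \<tau> *v C +
      (\<Sum>k=1..m. \<Phi>s k \<tau> *v (LBINT s=t k..\<tau>. matrix_inv (\<Phi> s) *v f s))"
    by (simp add: x_def p_def g_def)
  with sol unique show ?thesis
    by blast
qed

end
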